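(* Let $P$ be a definite program, let $P^{\delta}=Q\cup D$ be its transformed d-program, with Herbrand base $B_{P^\delta}=\{p_1,\ldots,p_m\}$, let $\bm{M}_{P^\delta}\in\mathbb{R}^{m\times m}$ be the program matrix of $P^\delta$ and let $\bm{v}_0\in\mathbb{R}^m$ be the initial vector of $P^\delta$. Then, for $\bm{m}\in\mathbb{R}^m$, $\bm{m}$ is the vector representing the least model of $P^\delta$ if and only if $\bm{m}=\mathsf{FP}(\bm{M}_{P^\delta}\bm{v}_0)$.
   Context: Programs. A definite program is a finite set of rules $h\leftarrow b_1\wedge\cdots\wedge b_l$ ($l\ge 0$), where $h$ and the $b_i$ are propositional variables and the $b_i$ are pairwise distinct; $head(r)=h$ and $body(r)=\{b_1,\ldots,b_l\}$. A rule with empty body is a fact, written $h\leftarrow$. A d-rule has the form $h\leftarrow b_1\vee\cdots\vee b_l$ (a shorthand for the rules $h\leftarrow b_1,\ldots,h\leftarrow b_l$). A d-program is a finite set of rules each of one of these two forms. The Herbrand base $B_P$ of a program $P$ is the set of all propositional variables appearing in $P$. A set $I\subseteq B_P$ (an interpretation) is a model of a d-program $P$ if $\{b_1,\ldots,b_l\}\subseteq I$ implies $h\in I$ for every conjunctive rule, and $\{b_1,\ldots,b_l\}\cap I\neq\emptyset$ implies $h\in I$ for every d-rule. The least model is the model contained in every model. An SD (singly defined) program is a definite program in which distinct rules have distinct heads. Transformation. Let $P$ be a definite program. For $p\in B_P$ let $P_p=\{r\in P: head(r)=p\}$, and let $R_p=P_p$ if $|P_p|>1$ and $R_p=\emptyset$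 otherwise. If $R_p=\{r_1,\ldots,r_k\}$ is nonempty ($k=|R_p|$), introduce pairwise distinct new propositional variables $p^{(1)},\ldots,p^{(k)}$, not in $B_P$ and distinct from those introduced for other atoms, and let $S_p$ be the set of the $k$ rules obtained from $r_1,\ldots,r_k$ by replacing the head of $r_i$ by $p^{(i)}$ (keeping its body), and let $D_p=\{p\leftarrow p^{(1)}\vee\cdots\vee p^{(k)}\}$; if $R_p=\emptyset$ then $S_p=D_p=\emptyset$. The transformed d-program is $P^\delta=Q\cup D$ where $Q=(P\setminus\bigcup_{p\in B_P}R_p)\cup\bigcup_{p\in B_P}S_p$ (an SD program) and $D=\bigcup_{p\in B_P}D_p$ (a set of d-rules). Vectors. With $B_{P^\delta}=\{p_1,\ldots,p_m\}$, an interpretation $I\subseteq B_{P^\delta}$ is represented by $(a_1,\ldots,a_m)^{\mathsf T}$ with $a_i=1$ if $p_i\in I$ and $a_i=0$ otherwise. The initial vector $\bm{v}_0$ of $P^\delta$ represents the set of atoms $p_i$ such that the fact $p_i\leftarrow$ is in $P^\delta$. Program matrix of $P^\delta$. $\bm{M}_{P^\delta}=(a_{ij})\in\mathbb{R}^{m\times m}$ is given by: (1) if $p_i\leftarrow p_{j_1}\vee\cdots\vee p_{j_l}$ is in $D$, then $a_{ij_k}=1$ for $1\le k\le l$; (2) if $p_i\leftarrow p_{j_1}\wedge\cdots\wedge p_{j_l}$ with $l\ge 1$ is in $Q$, then $a_{ij_k}=\frac1l$ for $1\le k\le l$; (3) if the fact $p_i\leftarrow$ is in $Q$, then $a_{ii}=1$;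 (4) all other entries are $0$. Thresholding. For $\bm{v}=(a_1,\ldots,a_m)^{\mathsf T}$, $\theta(\bm{v})=(a_1',\ldots,a_m')^{\mathsf T}$ where $a_i'=1$ if $a_i\ge 1$ and $a_i'=0$ otherwise. Fixpoint. Define $\bm{v}_{k+1}=\theta(\bm{M}_{P^\delta}\bm{v}_k)$ for $k\ge 0$, starting from the initial vector $\bm{v}_0$. There is some $k\ge 1$ with $\bm{v}_{k+1}=\bm{v}_k$, and for such $k$ one writes $\mathsf{FP}(\bm{M}_{P^\delta}\bm{v}_0)=\bm{v}_k$. *)

theory Defs
  imports "Jordan_Normal_Form.Matrix"
begin

text \<open>
  \<open>Conj h B\<close> is the rule whose body is the conjunction of the atoms in \<open>B\<close> (a fact if
  \<open>B = {}\<close>), and \<open>Disj h B\<close> is the d-rule whose body is their disjunction.  Bodies are sets,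
  so the body atoms are automatically pairwise distinct and \<open>l = card B\<close>.
\<close>

datatype 'a rule =
    Conj (head: 'a) (body: "'a set")
  | Disj (head: 'a) (body: "'a set")

definition definite_program :: "'a rule set \<Rightarrow> bool" where
  "definite_program P \<longleftrightarrow> finite P \<and> (\<forall>r\<in>P. is_Conj r \<and> finite (body r))"

definition herbrand_base :: "'a rule set \<Rightarrow> 'a set" where
  "herbrand_base P = (\<Union>r\<in>P. insert (head r) (body r))"

fun satisfies :: "'a set \<Rightarrow> 'a rule \<Rightarrow> bool" where
  "satisfies I (Conj h B) \<longleftrightarrow> (B \<subseteq> I \<longrightarrow> h \<in> I)"
| "satisfies I (Disj h B) \<longleftrightarrow> (B \<inter> I \<noteq> {} \<longrightarrow> h \<in> I)"

definition model :: "'a rule set \<Rightarrow> 'a set \<Rightarrow> bool" where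
  "model P I \<longleftrightarrow> I \<subseteq> herbrand_base P \<and> (\<forall>r\<in>P. satisfies I r)"

definition least_model :: "'a rule set \<Rightarrow> 'a set \<Rightarrow> bool" where
  "least_model P I \<longleftrightarrow> model P I \<and> (\<forall>J. model P J \<longrightarrow> I \<subseteq> J)"

definition multi_rules :: "'a rule set \<Rightarrow> 'a \<Rightarrow> 'a rule set" where
  "multi_rules P p =
    (let Pp = {r \<in> P. head r = p} in if card Pp > 1 then Pp else {})"

definition all_multi_rules :: "'a rule set \<Rightarrow> 'a rule set" where
  "all_multi_rules P = (\<Union>p\<in>herbrand_base P. multi_rules P p)"

text \<open>
  The new atoms are named by the rules they come from: if \<open>r\<^sub>1, \<dots>, r\<^sub>k\<close> are the rules in
  \<open>multi_rules P p\<close>, then \<open>new r\<^sub>i\<close> is the atom \<open>p\<^sup>(\<^sup>i\<^sup>)\<close>.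
  Any choice of pairwise distinct atoms outside the Herbrand base is admitted.
\<close>

definition fresh_atoms :: "'a rule set \<Rightarrow> ('a rule \<Rightarrow> 'a) \<Rightarrow> bool" where
  "fresh_atoms P new \<longleftrightarrow>
    inj_on new (all_multi_rules P) \<and> new ` all_multi_rules P \<inter> herbrand_base P = {}"

definition split_rules :: "('a rule \<Rightarrow> 'a) \<Rightarrow> 'a rule set \<Rightarrow> 'a \<Rightarrow> 'a rule set" where
  "split_rules new P p = (\<lambda>r. Conj (new r) (body r)) ` multi_rules P p"

definition d_rules :: "('a rule \<Rightarrow> 'a) \<Rightarrow> 'a rule set \<Rightarrow> 'a \<Rightarrow> 'a rule set" where
  "d_rules new P p =
    (if multi_rules P p = {} then {} else {Disj p (new ` multi_rules P p)})"

definition conj_part :: "('a rule \<Rightarrow> 'a) \<Rightarrow> 'a rule set \<Rightarrow> 'a rule set" where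
  "conj_part new P =
    (P - all_multi_rules P) \<union> (\<Union>p\<in>herbrand_base P. split_rules new P p)"

definition disj_part :: "('a rule \<Rightarrow> 'a) \<Rightarrow> 'a rule set \<Rightarrow> 'a rule set" where
  "disj_part new P = (\<Union>p\<in>herbrand_base P. d_rules new P p)"

definition transformed :: "('a rule \<Rightarrow> 'a) \<Rightarrow> 'a rule set \<Rightarrow> 'a rule set" where
  "transformed new P = conj_part new P \<union> disj_part new P"

text \<open>
  Below, the list \<open>ps\<close> enumerates the Herbrand base without repetition.  The entry of index
  \<open>i\<close>, counted from 0, of a vector or matrix belongs to the atom \<open>ps ! i\<close>.
\<close>

definition interp_vec :: "'a list \<Rightarrow> 'a set \<Rightarrow> real vec" where
  "interp_vec ps I = vec (length ps) (\<lambda>i. if ps ! i \<in> I then 1 else 0)"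

definition initial_vec :: "'a list \<Rightarrow> 'a rule set \<Rightarrow> real vec" where
  "initial_vec ps P = interp_vec ps {p. Conj p {} \<in> P}"

text \<open>
  For a transformed program \<open>P\<close> the rules of the form \<open>Disj\<close> are those of its d-rule part and
  those of the form \<open>Conj\<close> are those of its SD part.  Distinct rules have distinct heads there,
  so at most one case applies to each entry and the body denoted by \<open>THE\<close> is unique.
\<close>

definition program_matrix :: "'a list \<Rightarrow> 'a rule set \<Rightarrow> real mat" where
  "program_matrix ps P = mat (length ps) (length ps) (\<lambda>(i, j).
     if \<exists>B. Disj (ps ! i) B \<in> P \<and> ps ! j \<in> B then 1
     else if \<exists>B. Conj (ps ! i) B \<in> P \<and> ps ! j \<in> B
       then 1 / real (card (THE B. Conj (ps ! i) B \<in> P))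
     else if Conj (ps ! i) {} \<in> P \<and> i = j then 1
     else 0)"

definition threshold :: "real vec \<Rightarrow> real vec" where
  "threshold v = map_vec (\<lambda>a. if a \<ge> 1 then 1 else 0) v"

definition iter_vec :: "real mat \<Rightarrow> real vec \<Rightarrow> nat \<Rightarrow> real vec" where
  "iter_vec M v0 k = ((\<lambda>v. threshold (M *\<^sub>v v)) ^^ k) v0"

text \<open>
  Once two consecutive iterates agree the sequence is constant, so the value is unique
  whenever such a \<open>k\<close> exists.
\<close>

definition FP :: "real mat \<Rightarrow> real vec \<Rightarrow> real vec" where
  "FP M v0 = (THE w. \<exists>k\<ge>1. iter_vec M v0 (Suc k) = iter_vec M v0 k \<and> w = iter_vec M v0 k)"

end

theory Submission
  imports Defs
begin

text \<open>
  In \<open>P\<^sup>\<delta>\<close> every atom is the head of at most one rule, so row \<open>i\<close> of the program matrix encodes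
  exactly that rule: thresholding the product with the vector of \<open>I\<close> yields the vector of the
  immediate consequences of \<open>I\<close>, except that a fact is kept rather than generated.  Since the
  iteration starts from the facts, it is increasing, hence becomes stationary, and its limit
  is a model contained in every model.
\<close>

section \<open>Immediate consequences and the least model\<close>

definition consequences :: "'a rule set \<Rightarrow> 'a set \<Rightarrow> 'a set" where
  "consequences P I = {h. (\<exists>B. Disj h B \<in> P \<and> B \<inter> I \<noteq> {}) \<or>
     (\<exists>B. Conj h B \<in> P \<and> B \<noteq> {} \<and> B \<subseteq> I) \<or> (Conj h {} \<in> P \<and> h \<in> I)}"

definition facts :: "'a rule set \<Rightarrow> 'a set" where
  "facts P = {p. Conj p {} \<in> P}"

lemma consequences_mono: "I \<subseteq> J \<Longrightarrow> consequences P I \<subseteq> consequences P J"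
  unfolding consequences_def by blast

lemma facts_subset_consequences: "facts P \<subseteq> consequences P (facts P)"
  by (auto simp: consequences_def facts_def)

lemma rule_subset_herbrand_base:
  assumes "r \<in> P"
  shows "head r \<in> herbrand_base P" "body r \<subseteq> herbrand_base P"
  using assms by (auto simp: herbrand_base_def)

lemma facts_subset_herbrand_base: "facts P \<subseteq> herbrand_base P"
  unfolding facts_def using rule_subset_herbrand_base(1) by fastforce

lemma consequences_subset_herbrand_base: "consequences P I \<subseteq> herbrand_base P"
  unfolding consequences_def using rule_subset_herbrand_base(1) by fastforce

lemma model_facts: "model P J \<Longrightarrow> facts P \<subseteq> J"
  by (fastforce simp: model_def facts_def)

lemma model_consequences: "model P J \<Longrightarrow> consequences P J \<subseteq> J"
  by (fastforce simp: model_def consequences_def)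

text \<open>The facts need a hypothesis of their own: \<open>consequences\<close> only preserves
  facts already in \<open>I\<close>, so closure under it does not force them in.\<close>

lemma model_if_consequences_subset:
  assumes "I \<subseteq> herbrand_base P" "facts P \<subseteq> I" "consequences P I \<subseteq> I"
  shows "model P I"
proof -
  have "satisfies I r" if "r \<in> P" for r
  proof (cases r)
    case (Conj h B)
    then show ?thesis
      using that assms(2,3) by (cases "B = {}") (auto simp: facts_def consequences_def)
  next
    case (Disj h B)
    then have "h \<in> consequences P I" if "B \<inter> I \<noteq> {}"
      using that \<open>r \<in> P\<close> by (auto simp: consequences_def)
    then show ?thesis using Disj assms(3) by auto
  qed
  with assms(1) show ?thesis by (simp add: model_def)
qed

lemma funpow_consequences_subset_herbrand_base:
  "(consequences P ^^ k) (facts P) \<subseteq> herbrand_base P"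
  by (cases k) (use facts_subset_herbrand_base consequences_subset_herbrand_base in fastforce)+

lemma funpow_consequences_increasing:
  "(consequences P ^^ k) (facts P) \<subseteq> (consequences P ^^ Suc k) (facts P)"
proof (induction k)
  case 0
  show ?case using facts_subset_consequences by simp
next
  case (Suc k)
  show ?case using consequences_mono[OF Suc] by simp
qed

lemma funpow_consequences_subset_model:
  assumes "model P J"
  shows "(consequences P ^^ k) (facts P) \<subseteq> J"
proof (induction k)
  case 0
  show ?case using model_facts[OF assms] by simp
next
  case (Suc k)
  show ?case using consequences_mono[OF Suc, of P] model_consequences[OF assms] by auto
qed

text \<open>Stationarity gives closure under \<open>consequences\<close>, monotonicity of the chain
  keeps the facts, and every iterate lies below every model.\<close>

lemma least_model_if_stationary:
  assumes "(consequences P ^^ Suc k) (facts P) = (consequences P ^^ k) (facts P)"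
  shows "least_model P ((consequences P ^^ k) (facts P))"
proof -
  have "facts P \<subseteq> (consequences P ^^ k) (facts P)"
    using lift_Suc_mono_le[of "\<lambda>k. (consequences P ^^ k) (facts P)" 0 k]
      funpow_consequences_increasing[of _ P] by simp
  then have "model P ((consequences P ^^ k) (facts P))"
    using assms by (intro model_if_consequences_subset funpow_consequences_subset_herbrand_base) auto
  then show ?thesis
    using funpow_consequences_subset_model by (auto simp: least_model_def)
qed

text \<open>The iterates grow inside a finite set. At an index of maximal cardinality the inclusion
  into the next iterate must be an equality.\<close>

lemma funpow_consequences_stationary:
  assumes "finite (herbrand_base P)"
  obtains k where "(consequences P ^^ Suc k) (facts P) = (consequences P ^^ k) (facts P)"
proof -
  let ?A = "\<lambda>k. (consequences P ^^ k) (facts P)"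
  have fin: "finite (?A k)" for k
    using assms funpow_consequences_subset_herbrand_base by (rule finite_subset[rotated])
  have "card (?A k) \<le> card (herbrand_base P)" for k
    using assms funpow_consequences_subset_herbrand_base by (rule card_mono)
  then have "\<exists>k. True \<and> (\<forall>y. True \<longrightarrow> card (?A y) \<le> card (?A k))"
    by (intro ex_has_greatest_nat[of _ 0 _ "Suc (card (herbrand_base P))"])
      (auto simp: less_Suc_eq_le)
  then obtain k where "card (?A (Suc k)) \<le> card (?A k)" by blast
  then have "?A k = ?A (Suc k)"
    by (intro card_seteq fin funpow_consequences_increasing)
  then show thesis using that[of k] by simp
qed

lemma least_model_unique: "least_model P I \<Longrightarrow> least_model P J \<Longrightarrow> I = J"
  by (auto simp: least_model_def)

section \<open>One thresholded matrix step as a consequence step\<close>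

lemma ratio_ge_1_iff_subset:
  assumes "finite B" "B \<noteq> {}"
  shows "1 \<le> real (card (B \<inter> I)) / real (card B) \<longleftrightarrow> B \<subseteq> I"
proof -
  \<comment> \<open>Nonemptiness is essential: for \<open>B = {}\<close> the quotient is 0 by the
    convention on division by zero, although the inclusion holds.\<close>
  have "0 < card B" using assms by (simp add: card_gt_0_iff)
  then have "1 \<le> real (card (B \<inter> I)) / real (card B) \<longleftrightarrow> card B \<le> card (B \<inter> I)"
    by (simp add: le_divide_eq)
  also have "\<dots> \<longleftrightarrow> B \<inter> I = B"
    using assms(1) card_seteq[of B "B \<inter> I"] by auto
  also have "\<dots> \<longleftrightarrow> B \<subseteq> I" by blast
  finally show ?thesis .
qed

lemma threshold_program_matrix:
  assumes inj: "inj_on head P" and ps: "distinct ps" "set ps = herbrand_base P"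
  shows "threshold (program_matrix ps P *\<^sub>v interp_vec ps I) = interp_vec ps (consequences P I)"
proof (rule eq_vecI)
  fix i assume "i < dim_vec (interp_vec ps (consequences P I))"
  then have i: "i < length ps" by (simp add: interp_vec_def)
  define p where "p = ps ! i"
  \<comment> \<open>\<open>c q\<close> is the entry of row \<open>i\<close> in the column of
    \<open>q\<close>, indexed by atoms instead of positions. Distinctness of \<open>ps\<close> turns
    the test \<open>i = j\<close> into \<open>p = q\<close>.\<close>
  define c where "c q =
    (if \<exists>B. Disj p B \<in> P \<and> q \<in> B then 1
     else if \<exists>B. Conj p B \<in> P \<and> q \<in> B then 1 / real (card (THE B. Conj p B \<in> P))
     else if Conj p {} \<in> P \<and> p = q then 1 else 0)" for q
  have one_rule: "r = s" if "r \<in> P" "s \<in> P" "head r = p" "head s = p" for r s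
    using inj that by (auto dest: inj_onD)
  have entry: "(program_matrix ps P *\<^sub>v interp_vec ps I) $ i = (\<Sum>q\<in>set ps \<inter> I. c q)"
  proof -
    have "(program_matrix ps P *\<^sub>v interp_vec ps I) $ i =
        (\<Sum>j<length ps. c (ps ! j) * (if ps ! j \<in> I then 1 else 0))"
      using i ps(1)
      by (auto simp: program_matrix_def interp_vec_def scalar_prod_def c_def p_def
          nth_eq_iff_index_eq lessThan_atLeast0 intro!: sum.cong)
    also have "\<dots> = (\<Sum>q\<in>set ps. c q * (if q \<in> I then 1 else 0))"
      using ps(1) by (intro sum.reindex_bij_betw bij_betw_nth) auto
    also have "\<dots> = (\<Sum>q\<in>set ps \<inter> I. c q)"
      by (rule sum.mono_neutral_cong_right) auto
    finally show ?thesis .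
  qed
  have "1 \<le> (\<Sum>q\<in>set ps \<inter> I. c q) \<longleftrightarrow> p \<in> consequences P I"
  proof (cases "\<exists>r\<in>P. head r = p")
    case False
    then have no: "Disj p B \<notin> P" "Conj p B \<notin> P" for B by force+
    then have "c q = 0" for q by (simp add: c_def)
    then show ?thesis using no by (simp add: consequences_def)
  next
    case True
    then obtain r where r: "r \<in> P" "head r = p" by blast
    have sub: "body r \<subseteq> set ps" using rule_subset_herbrand_base(2)[OF r(1)] ps(2) by simp
    have p_in: "p \<in> set ps" using i by (simp add: p_def)
    have sum_body: "(\<Sum>q\<in>set ps \<inter> I. if q \<in> body r then a else 0) = card (body r \<inter> I) * a"
      for a :: real
    proof -
      have "(\<Sum>q\<in>set ps \<inter> I. if q \<in> body r then a else 0) = (\<Sum>q\<in>body r \<inter> I. a)"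
        using sub by (intro sum.mono_neutral_cong_right) auto
      then show ?thesis by simp
    qed
    have fin: "finite (body r)" using sub by (rule finite_subset) simp
    show ?thesis
    proof (cases r)
      case (Disj h B)
      \<comment> \<open>\<open>D\<close> and \<open>C\<close> list all rules with head
        \<open>p\<close>, so every case distinction in \<open>c\<close> can be decided; in the
        conjunctive case their analogues also evaluate the \<open>THE\<close>.\<close>
      have D: "Disj p B' \<in> P \<longleftrightarrow> B' = B" and C: "Conj p B' \<notin> P" for B'
        using one_rule[OF r(1) _ r(2), of "Disj p B'"] one_rule[OF r(1) _ r(2), of "Conj p B'"]
          r Disj by auto
      have "c q = (if q \<in> body r then 1 else 0)" for q
        using Disj by (simp add: c_def D C)
      \<comment> \<open>The row of a d-rule counts its true body atoms; this integer reaches 1 as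
        soon as one is true.\<close>
      then have "(\<Sum>q\<in>set ps \<inter> I. c q) = card (B \<inter> I)"
        using sum_body[of 1] Disj by simp
      moreover have "1 \<le> card (B \<inter> I) \<longleftrightarrow> B \<inter> I \<noteq> {}"
        using fin Disj by (simp add: Suc_le_eq card_gt_0_iff)
      ultimately show ?thesis by (simp add: consequences_def D C)
    next
      case (Conj h B)
      have C: "Conj p B' \<in> P \<longleftrightarrow> B' = B" and D: "Disj p B' \<notin> P" for B'
        using one_rule[OF r(1) _ r(2), of "Disj p B'"] one_rule[OF r(1) _ r(2), of "Conj p B'"]
          r Conj by auto
      show ?thesis
      proof (cases "B = {}")
        case True
        \<comment> \<open>For a fact only the diagonal entry survives, so the sum is 1 or 0
          according to whether \<open>p\<close> is already in \<open>I\<close>.\<close>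
        have "(\<Sum>q\<in>set ps \<inter> I. c q) = (\<Sum>q\<in>set ps \<inter> I. if p = q then 1 else 0)"
          using True by (simp add: c_def D C)
        then show ?thesis using p_in True by (simp add: consequences_def D C)
      next
        case False
        have "c q = (if q \<in> body r then 1 / card B else 0)" for q
          using Conj False by (simp add: c_def D C)
        \<comment> \<open>The row of a conjunctive rule yields the fraction of true body atoms,
          which reaches 1 only when all are true.\<close>
        then have "(\<Sum>q\<in>set ps \<inter> I. c q) = card (B \<inter> I) / card B"
          using sum_body[of "1 / card B"] Conj by simp
        then show ?thesis
          using ratio_ge_1_iff_subset[of B I] fin Conj False by (simp add: consequences_def D C)
      qed
    qed
  qed
  then show "threshold (program_matrix ps P *\<^sub>v interp_vec ps I) $ i =
      interp_vec ps (consequences P I) $ i"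
    using i entry
    by (simp add: threshold_def interp_vec_def program_matrix_def p_def)
qed (simp add: threshold_def interp_vec_def program_matrix_def)

section \<open>The matrix iteration and its fixpoint\<close>

lemma iter_vec_program_matrix:
  assumes "inj_on head P" "distinct ps" "set ps = herbrand_base P"
  shows "iter_vec (program_matrix ps P) (initial_vec ps P) k =
    interp_vec ps ((consequences P ^^ k) (facts P))"
  by (induction k)
    (simp_all add: iter_vec_def initial_vec_def facts_def threshold_program_matrix[OF assms])

lemma FP_eqI:
  assumes "k \<ge> 1" "iter_vec M v (Suc k) = iter_vec M v k"
  shows "FP M v = iter_vec M v k"
proof -
  have const: "iter_vec M v (k + n) = iter_vec M v k"
    if "iter_vec M v (Suc k) = iter_vec M v k" for k n
    using that by (induction n) (simp_all add: iter_vec_def)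
  show ?thesis
    unfolding FP_def
  proof (rule the_equality)
    fix w assume "\<exists>k\<ge>1. iter_vec M v (Suc k) = iter_vec M v k \<and> w = iter_vec M v k"
    then obtain l where "iter_vec M v (Suc l) = iter_vec M v l" "w = iter_vec M v l" by blast
    then show "w = iter_vec M v k"
      \<comment> \<open>Two stationary values agree because both equal the iterate at
        \<open>k + l\<close>.\<close>
      using const[OF assms(2), of l] const[of l k] by (simp add: add.commute)
  qed (use assms in blast)
qed

lemma FP_program_matrix:
  assumes "inj_on head P" "distinct ps" "set ps = herbrand_base P"
  obtains I where "least_model P I"
    "FP (program_matrix ps P) (initial_vec ps P) = interp_vec ps I"
proof -
  have "finite (herbrand_base P)" using assms(3) by (metis List.finite_set)
  then obtain k where "(consequences P ^^ Suc k) (facts P) = (consequences P ^^ k) (facts P)"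
    by (rule funpow_consequences_stationary)
  \<comment> \<open>\<open>FP\<close> demands an index of at least 1, while the \<open>k\<close>
    obtained may be 0; its successor is stationary too.\<close>
  then have stat:
    "(consequences P ^^ Suc (Suc k)) (facts P) = (consequences P ^^ Suc k) (facts P)" by simp
  have "FP (program_matrix ps P) (initial_vec ps P) =
      interp_vec ps ((consequences P ^^ Suc k) (facts P))"
    unfolding iter_vec_program_matrix[OF assms, symmetric]
    by (rule FP_eqI) (simp_all only: iter_vec_program_matrix[OF assms] stat)
  with least_model_if_stationary[OF stat] show thesis using that by blast
qed

section \<open>Distinct heads in the transformed program\<close>

lemma mem_all_multi_rules:
  "r \<in> all_multi_rules P \<longleftrightarrow> r \<in> P \<and> card {s \<in> P. head s = head r} > 1"
  using rule_subset_herbrand_base(1)[of r P]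
  by (auto simp: all_multi_rules_def multi_rules_def Let_def split: if_splits)

text \<open>Three kinds of rules occur. Kept rules have old heads defined once, split rules have
  fresh heads, d-rules have old heads defined several times, so kinds cannot clash. Within a kind,
  the head determines the rule.\<close>

lemma inj_on_head_transformed:
  assumes "definite_program P" "fresh_atoms P new"
  shows "inj_on head (transformed new P)"
proof (rule inj_onI)
  have fresh: "new r \<notin> herbrand_base P" if "r \<in> all_multi_rules P" for r
    using assms(2) that by (auto simp: fresh_atoms_def)
  have new_inj: "r = s" if "r \<in> all_multi_rules P" "s \<in> all_multi_rules P" "new r = new s" for r s
    using assms(2) that by (auto simp: fresh_atoms_def dest: inj_onD)
  have single: "r = s"
    if "r \<in> P" "r \<notin> all_multi_rules P" "s \<in> P" "head r = head s" for r s
  proof -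
    have "finite {s \<in> P. head s = head r}" using assms(1) by (simp add: definite_program_def)
    moreover have "card {s \<in> P. head s = head r} \<le> 1"
      using that by (auto simp: mem_all_multi_rules)
    ultimately show ?thesis using that by (auto simp: card_le_Suc0_iff_eq)
  qed
  have shape: "(r \<in> P \<and> r \<notin> all_multi_rules P) \<or>
      (\<exists>s\<in>all_multi_rules P. r = Conj (new s) (body s)) \<or>
      (\<exists>s\<in>all_multi_rules P. r = Disj (head s) (new ` multi_rules P (head s)))"
    if "r \<in> transformed new P" for r
  proof -
    have "r \<in> all_multi_rules P" "head r = p" if "r \<in> multi_rules P p" for r p
      using that by (auto simp: mem_all_multi_rules multi_rules_def Let_def split: if_splits)
    then have "(\<exists>s\<in>all_multi_rules P. r = Disj (head s) (new ` multi_rules P (head s)))"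
      if "r \<in> d_rules new P p" for r p
      using that by (force simp: d_rules_def split: if_splits)
    moreover have "\<exists>s\<in>all_multi_rules P. r = Conj (new s) (body s)"
      if "r \<in> split_rules new P p" "p \<in> herbrand_base P" for r p
      using that by (auto simp: split_rules_def all_multi_rules_def)
    ultimately show ?thesis
      using that by (auto simp: transformed_def conj_part_def disj_part_def)
  qed
  have in_P: "s \<in> P" "head s \<in> herbrand_base P" if "s \<in> all_multi_rules P" for s
    using that rule_subset_herbrand_base(1)[of s P] by (auto simp: mem_all_multi_rules)
  have old_head: "head r \<noteq> head s"
    if "r \<in> P" "r \<notin> all_multi_rules P" "s \<in> all_multi_rules P" for r s
    using that by (auto simp: mem_all_multi_rules)
  fix r s
  assume r: "r \<in> transformed new P" and s: "s \<in> transformed new P" and eq: "head r = head s"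
  show "r = s"
    using shape[OF r]
  proof (elim disjE conjE bexE)
    assume "r \<in> P" "r \<notin> all_multi_rules P"
    then show ?thesis
      using shape[OF s] eq single[of r s] fresh rule_subset_herbrand_base(1)[of r P]
      by (auto simp: old_head)
  next
    fix t assume t: "t \<in> all_multi_rules P" and r_eq: "r = Conj (new t) (body t)"
    then have new_head: "head s = new t" using eq by simp
    show ?thesis
      using shape[OF s]
    proof (elim disjE conjE bexE)
      assume "s \<in> P"
      then show ?thesis
        using fresh[OF t] rule_subset_herbrand_base(1)[of s P] new_head by simp
    next
      fix u assume "u \<in> all_multi_rules P" "s = Conj (new u) (body u)"
      then show ?thesis using new_inj[OF t, of u] new_head r_eq by simp
    next
      fix u assume "u \<in> all_multi_rules P" "s = Disj (head u) (new ` multi_rules P (head u))"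
      then show ?thesis using fresh[OF t] in_P(2)[of u] new_head by simp
    qed
  next
    fix t assume t: "t \<in> all_multi_rules P"
      and r_eq: "r = Disj (head t) (new ` multi_rules P (head t))"
    then have old: "head s = head t" using eq by simp
    show ?thesis
      using shape[OF s]
    proof (elim disjE conjE bexE)
      assume "s \<in> P" "s \<notin> all_multi_rules P"
      then show ?thesis using old_head[of s t] t old by simp
    next
      fix u assume "u \<in> all_multi_rules P" "s = Conj (new u) (body u)"
      then show ?thesis using fresh[of u] in_P(2)[OF t] old by simp
    next
      fix u assume "s = Disj (head u) (new ` multi_rules P (head u))"
      then show ?thesis using old r_eq by simp
    qed
  qed
qed

theorem theorem2:
  fixes P :: "'a rule set" and new :: "'a rule \<Rightarrow> 'a"
    and ps :: "'a list" and m :: "real vec"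
  assumes "definite_program P"
    and "fresh_atoms P new"
    and "distinct ps" and "set ps = herbrand_base (transformed new P)"
    and "m \<in> carrier_vec (length ps)"
  shows "(\<exists>I. least_model (transformed new P) I \<and> m = interp_vec ps I) \<longleftrightarrow>
    m = FP (program_matrix ps (transformed new P)) (initial_vec ps (transformed new P))"
  using FP_program_matrix[OF inj_on_head_transformed[OF assms(1,2)] assms(3,4)]
    least_model_unique by metis

end
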